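(* Let $A_{ij}$, $1\le i\le k$, $1\le j\le n$, be positive semidefinite Hermitian matrices, all of the same order, such that for each $i$, $A_{i1}\preceq_L A_{i2}\preceq_L\cdots\preceq_L A_{in}$, and such that $A_{ij}$ commutes with $A_{ml}$ for all $i\ne m$ and all $j,l$. Then for all permutations $\sigma_1,\dots,\sigma_k\in S_n$, $$\sum_{i=1}^n\prod_{j=1}^k A_{j\sigma_j(i)}\preceq_L\sum_{i=1}^n\prod_{j=1}^k A_{ji}.$$ If in addition $A_{ij}$ commutes with $A_{ml}$ for all $i,j,m,l$, then for all permutations $\sigma_1,\dots,\sigma_k\in S_n$, $$\prod_{i=1}^n\sum_{j=1}^k A_{j\sigma_j(i)}\succeq_L\prod_{i=1}^n\sum_{j=1}^k A_{ji}.$$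
   Context: $\preceq_L$ is the Loewner partial order on Hermitian matrices: $A\succeq_L B$ if and only if $A-B$ is positive semidefinite. Products are matrix products. $S_n$ is the symmetric group on $\{1,\dots,n\}$. *)

theory Defs
  imports "HOL-Analysis.Analysis"
begin

definition conj_transpose :: "complex^'m^'n \<Rightarrow> complex^'n^'m" where
  "conj_transpose A = (\<chi> i j. cnj (A $ j $ i))"

definition hermitian_mat :: "complex^'m^'m \<Rightarrow> bool" where
  "hermitian_mat A \<longleftrightarrow> conj_transpose A = A"

definition psd :: "complex^'m^'m \<Rightarrow> bool" where
  "psd A \<longleftrightarrow> hermitian_mat A \<and>
     (\<forall>x :: complex^'m. (\<Sum>i\<in>UNIV. cnj (x $ i) * (A *v x) $ i) \<in> \<real>\<^sub>\<ge>\<^sub>0)"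

text \<open>The Loewner order is an order on Hermitian matrices only, so it is
  made false unless both sides are Hermitian. (If \<open>B - A\<close> is positive semidefinite,
  then \<open>A\<close> is Hermitian iff \<open>B\<close> is, but neither need be.)\<close>

definition loewner_le :: "complex^'m^'m \<Rightarrow> complex^'m^'m \<Rightarrow> bool"
    (infix \<open>\<preceq>\<^sub>L\<close> 50) where
  "A \<preceq>\<^sub>L B \<longleftrightarrow> hermitian_mat A \<and> hermitian_mat B \<and> psd (B - A)"

definition commutes_with :: "complex^'m^'m \<Rightarrow> complex^'m^'m \<Rightarrow> bool" where
  "commutes_with A B \<longleftrightarrow> A ** B = B ** A"

text \<open>The ordered matrix product \<open>F 1 ** F 2 ** \<dots> ** F k\<close>, which is \<open>mat 1\<close> if \<open>k = 0\<close>.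
  The library's \<open>prod\<close> (\<open>\<Prod>\<close>) is unsuitable: multiplication \<open>*\<close> on type \<open>vec\<close> is entrywise.\<close>

definition mat_prod :: "nat \<Rightarrow> (nat \<Rightarrow> complex^'m^'m) \<Rightarrow> complex^'m^'m" where
  "mat_prod k F = foldr (\<lambda>i M. F i ** M) [1..<Suc k] (mat 1)"

end

theory Submission
  imports Defs
begin

text \<open>Both inequalities rest on the fact that a product of commuting positive semidefinite matrices is
  positive semidefinite. For sums of products, write the \<open>l\<close>-th matrix of a chain as the sum of the
  positive semidefinite increments up to \<open>l\<close>; expanding one factor this way leaves sums over the indices
  with \<open>t \<le> \<sigma> i\<close>, which are as numerous for \<open>\<sigma>\<close> as for the identity, but only in the
  sorted arrangement do they consist of the largest indices in every factor. For products of sums,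
  sorting two positions in all rows at once replaces the factors \<open>m + p\<close>, \<open>m + q\<close> by \<open>m\<close>,
  \<open>m + p + q\<close> with \<open>m, p, q\<close> positive semidefinite, which lowers the product by \<open>p ** q\<close>.\<close>

section \<open>Hermitian matrices and their quadratic forms\<close>

lemma conj_transpose_mult: "conj_transpose (A ** B) = conj_transpose B ** conj_transpose A"
  by (simp add: conj_transpose_def matrix_matrix_mult_def vec_eq_iff mult.commute)

lemma hermitian_mat_zero [simp]: "hermitian_mat 0"
  by (simp add: hermitian_mat_def conj_transpose_def vec_eq_iff)

lemma hermitian_mat_mat_1 [simp]: "hermitian_mat (mat 1)"
  by (simp add: hermitian_mat_def conj_transpose_def vec_eq_iff mat_def)

lemma hermitian_mat_add: "hermitian_mat A \<Longrightarrow> hermitian_mat B \<Longrightarrow> hermitian_mat (A + B)"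
  by (simp add: hermitian_mat_def conj_transpose_def vec_eq_iff)

lemma hermitian_mat_mult:
  "hermitian_mat A \<Longrightarrow> hermitian_mat B \<Longrightarrow> commutes_with A B \<Longrightarrow> hermitian_mat (A ** B)"
  by (simp add: hermitian_mat_def commutes_with_def conj_transpose_mult)

lemma hermitian_form_swap:
  assumes "hermitian_mat A"
  shows "(\<Sum>i\<in>UNIV. cnj ((A *v x) $ i) * y $ i) = (\<Sum>i\<in>UNIV. cnj (x $ i) * (A *v y) $ i)"
proof -
  have c: "cnj (A $ i $ j) = A $ j $ i" for i j
    using assms unfolding hermitian_mat_def conj_transpose_def vec_eq_iff by auto
  have "(\<Sum>i\<in>UNIV. cnj ((A *v x) $ i) * y $ i)
      = (\<Sum>i\<in>UNIV. \<Sum>j\<in>UNIV. A $ j $ i * cnj (x $ j) * y $ i)"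
    by (simp add: matrix_vector_mult_def sum_distrib_right c)
  also have "\<dots> = (\<Sum>j\<in>UNIV. \<Sum>i\<in>UNIV. A $ j $ i * cnj (x $ j) * y $ i)"
    by (rule sum.swap)
  also have "\<dots> = (\<Sum>i\<in>UNIV. cnj (x $ i) * (A *v y) $ i)"
    by (simp add: matrix_vector_mult_def sum_distrib_left mult_ac)
  finally show ?thesis .
qed

text \<open>The inner product of the type is the real one, so \<open>complex^'m\<close> counts as a
  real Euclidean space. This link lets real arguments on compact spheres and symmetric operators
  apply to complex matrices.\<close>

lemma inner_eq_Re_form: "x \<bullet> (y::complex^'m) = Re (\<Sum>i\<in>UNIV. cnj (x $ i) * y $ i)"
  by (simp add: inner_vec_def inner_complex_def)

lemma hermitian_inner_swap:
  fixes A :: "complex^'m^'m"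
  assumes "hermitian_mat A"
  shows "(A *v x) \<bullet> y = x \<bullet> (A *v y)"
  unfolding inner_eq_Re_form hermitian_form_swap[OF assms] ..

text \<open>For a Hermitian matrix the form \<open>cnj x * A x\<close> equals its own conjugate, so
  it is real and only the sign of its real part is left to check.\<close>

lemma psd_iff_inner:
  fixes A :: "complex^'m^'m"
  shows "psd A \<longleftrightarrow> hermitian_mat A \<and> (\<forall>x. 0 \<le> x \<bullet> (A *v x))"
proof -
  have "Im (\<Sum>i\<in>UNIV. cnj (x $ i) * (A *v x) $ i) = 0" if "hermitian_mat A" for x
  proof -
    let ?q = "\<Sum>i\<in>UNIV. cnj (x $ i) * (A *v x) $ i"
    have "cnj ?q = ?q"
      using hermitian_form_swap[OF that, of x x] by (simp add: mult.commute)
    then show ?thesis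
      by (metis Reals_cnj_iff complex_is_Real_iff)
  qed
  then show ?thesis
    unfolding psd_def inner_eq_Re_form by (auto simp: complex_nonneg_Reals_iff)
qed

lemma psd_hermitian: "psd A \<Longrightarrow> hermitian_mat A"
  by (simp add: psd_def)

lemma psd_zero [simp]: "psd 0"
  by (simp add: psd_iff_inner)

lemma psd_mat_1 [simp]: "psd (mat 1)"
  by (simp add: psd_iff_inner)

lemma psd_add: "psd A \<Longrightarrow> psd B \<Longrightarrow> psd (A + B)"
  by (simp add: psd_iff_inner hermitian_mat_add matrix_vector_mult_add_rdistrib inner_add_right)

lemma psd_sum: "(\<And>i. i \<in> S \<Longrightarrow> psd (F i)) \<Longrightarrow> psd (sum F S)"
  by (induction S rule: infinite_finite_induct) (auto intro: psd_add)

section \<open>Products of commuting positive semidefinite matrices\<close>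

text \<open>At a zero of the form, a step of length \<open>s\<close> along \<open>- f x\<close>
  changes its value by \<open>- 2 * s * N\<close> to first order and by only
  \<open>s * s * q\<close> to second order, so a small step would make it negative unless
  \<open>f x = 0\<close>.\<close>

lemma nonneg_symmetric_form_zero:
  fixes f :: "'a::real_inner \<Rightarrow> 'a"
  assumes "linear f" and sym: "\<And>u v. f u \<bullet> v = u \<bullet> f v" and nonneg: "\<And>u. 0 \<le> u \<bullet> f u"
    and "x \<bullet> f x = 0"
  shows "f x = 0"
proof (rule ccontr)
  assume "f x \<noteq> 0"
  interpret linear f by fact
  define N where "N = f x \<bullet> f x"
  define q where "q = f x \<bullet> f (f x)"
  \<comment> \<open>This gives \<open>s * q < N\<close>, so the linear term wins; the
    \<open>+ 1\<close> keeps the denominator positive when \<open>q = 0\<close>.\<close>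
  define s where "s = N / (q + 1)"
  have "N > 0" using \<open>f x \<noteq> 0\<close> by (simp add: N_def)
  have "q \<ge> 0" using nonneg by (simp add: q_def)
  then have s: "s > 0" "s * (q + 1) = N" using \<open>N > 0\<close> by (auto simp: s_def)
  have "(x - s *\<^sub>R f x) \<bullet> f (x - s *\<^sub>R f x) = s * (s * q - 2 * N)"
    using \<open>x \<bullet> f x = 0\<close> sym[of x "f x"]
    by (simp add: diff scale inner_diff_left inner_diff_right N_def q_def algebra_simps)
  with nonneg[of "x - s *\<^sub>R f x"] s(1) have "s * q \<ge> 2 * N"
    by (simp add: zero_le_mult_iff)
  moreover have "s * q + s = N" using s(2) by (simp add: algebra_simps)
  ultimately show False using s(1) \<open>N > 0\<close> by linarith
qed

text \<open>A minimiser of the Rayleigh quotient \<open>x \<bullet> f x\<close> on the unit sphere is an eigenvector, because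
  it is a zero of the nonnegative form of \<open>f - \<lambda>\<close>.\<close>

lemma symmetric_negative_eigenvector:
  fixes f :: "'a::euclidean_space \<Rightarrow> 'a"
  assumes "linear f" and sym: "\<And>u v. f u \<bullet> v = u \<bullet> f v" and less: "y \<bullet> f y < 0"
  obtains x c where "x \<noteq> 0" "c < 0" "f x = c *\<^sub>R x"
proof -
  interpret linear f by fact
  have "continuous_on (sphere 0 1) (\<lambda>x. x \<bullet> f x)"
    by (intro continuous_intros linear_continuous_on linear_conv_bounded_linear[THEN iffD1] \<open>linear f\<close>)
  moreover have "compact (sphere (0::'a) 1)" "sphere (0::'a) 1 \<noteq> {}" by simp_all
  ultimately obtain x where x: "x \<in> sphere 0 1"
    and min: "\<And>u. u \<in> sphere 0 1 \<Longrightarrow> x \<bullet> f x \<le> u \<bullet> f u"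
    using continuous_attains_inf[of "sphere 0 1" "\<lambda>x. x \<bullet> f x"] by auto
  define c where "c = x \<bullet> f x"
  \<comment> \<open>By homogeneity the minimum on the sphere bounds the form everywhere, which makes
    the form of \<open>f - c\<close> nonnegative.\<close>
  have c: "c * (u \<bullet> u) \<le> u \<bullet> f u" for u
  proof (cases "u = 0")
    case False
    have "c \<le> (u /\<^sub>R norm u) \<bullet> f (u /\<^sub>R norm u)"
      unfolding c_def using False by (intro min) simp
    also have "\<dots> = (u \<bullet> f u) / (u \<bullet> u)"
      by (simp add: scale dot_square_norm power2_eq_square divide_simps)
    finally show ?thesis using False by (simp add: field_simps)
  qed simp
  have "linear (\<lambda>u. f u - c *\<^sub>R u)"
    by (intro linear_compose_sub \<open>linear f\<close> linear_scale_self)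
  then have "f x - c *\<^sub>R x = 0"
  proof (rule nonneg_symmetric_form_zero)
    show "0 \<le> u \<bullet> (f u - c *\<^sub>R u)" for u
      using c[of u] by (simp add: inner_diff_right)
    show "x \<bullet> (f x - c *\<^sub>R x) = 0"
      using x by (simp add: inner_diff_right c_def dot_square_norm)
  qed (simp add: sym inner_diff_left inner_diff_right)
  moreover have "c * (y \<bullet> y) < 0" using c[of y] less by linarith
  then have "c < 0" using inner_ge_zero[of y] by (auto simp: mult_less_0_iff)
  moreover have "x \<noteq> 0" using x by auto
  ultimately show thesis using that by simp
qed

text \<open>If \<open>A B x = c x\<close> with \<open>c < 0\<close>, then \<open>(B x)\<^sup>* A (B x) = c x\<^sup>* B x\<close> forces \<open>x\<^sup>* B x = 0\<close>, hence
  \<open>B x = 0\<close> and \<open>c x = 0\<close>.\<close>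

lemma psd_mult:
  fixes A B :: "complex^'m^'m"
  assumes A: "psd A" and B: "psd B" and comm: "commutes_with A B"
  shows "psd (A ** B)"
proof -
  have herm: "hermitian_mat (A ** B)"
    using A B comm by (intro hermitian_mat_mult psd_hermitian)
  have "0 \<le> y \<bullet> ((A ** B) *v y)" for y
  proof (rule ccontr)
    assume "\<not> ?thesis"
    then obtain x c where x: "x \<noteq> 0" "c < 0" "(A ** B) *v x = c *\<^sub>R x"
      using symmetric_negative_eigenvector[OF matrix_vector_mul_linear hermitian_inner_swap[OF herm]]
      by (metis not_le)
    have "0 \<le> (B *v x) \<bullet> (A *v (B *v x))"
      using A by (simp add: psd_iff_inner)
    also have "\<dots> = c * (x \<bullet> (B *v x))"
      using x(3) by (simp add: matrix_vector_mul_assoc inner_commute)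
    finally have "x \<bullet> (B *v x) \<le> 0"
      using \<open>c < 0\<close> by (simp add: zero_le_mult_iff)
    moreover have nonneg: "0 \<le> u \<bullet> (B *v u)" for u
      using B by (simp add: psd_iff_inner)
    ultimately have "x \<bullet> (B *v x) = 0" by (intro antisym)
    then have "B *v x = 0"
      by (rule nonneg_symmetric_form_zero[OF matrix_vector_mul_linear
          hermitian_inner_swap[OF psd_hermitian[OF B]] nonneg])
    then have "(A ** B) *v x = 0"
      by (simp flip: matrix_vector_mul_assoc)
    with x show False by simp
  qed
  with herm show ?thesis by (simp add: psd_iff_inner)
qed

section \<open>Distributivity and commutation\<close>

lemma matrix_diff_ldistrib: "A ** (B - C) = A ** B - A ** (C :: 'a::ring_1^'m^'n)"
  by (simp add: matrix_matrix_mult_def vec_eq_iff right_diff_distrib sum_subtractf)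

lemma matrix_diff_rdistrib: "(A - B) ** C = A ** C - B ** (C :: 'a::ring_1^'m^'n)"
  by (simp add: matrix_matrix_mult_def vec_eq_iff left_diff_distrib sum_subtractf)

lemma matrix_add_rdistrib: "(A + B) ** C = A ** C + B ** (C :: 'a::semiring_1^'m^'n)"
  by (simp add: matrix_matrix_mult_def vec_eq_iff distrib_right sum.distrib)

lemma matrix_sum_ldistrib: "A ** sum F S = (\<Sum>i\<in>S. A ** (F i :: 'a::semiring_1^'m^'n))"
  by (auto simp: matrix_matrix_mult_def vec_eq_iff sum_distrib_left intro: sum.swap)

lemma matrix_sum_rdistrib: "sum F S ** C = (\<Sum>i\<in>S. F i ** (C :: 'a::semiring_1^'m^'n))"
  by (auto simp: matrix_matrix_mult_def vec_eq_iff sum_distrib_right intro: sum.swap)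

lemma commutes_with_sym: "commutes_with A B \<Longrightarrow> commutes_with B A"
  by (simp add: commutes_with_def)

lemma commutes_with_diff:
  "commutes_with Z A \<Longrightarrow> commutes_with Z B \<Longrightarrow> commutes_with Z (A - B)"
  by (simp add: commutes_with_def matrix_diff_ldistrib matrix_diff_rdistrib)

lemma commutes_with_sum:
  "(\<And>i. i \<in> S \<Longrightarrow> commutes_with Z (F i)) \<Longrightarrow> commutes_with Z (sum F S)"
  by (simp add: commutes_with_def matrix_sum_ldistrib matrix_sum_rdistrib)

lemma commutes_with_mult:
  "commutes_with Z A \<Longrightarrow> commutes_with Z B \<Longrightarrow> commutes_with Z (A ** B)"
  unfolding commutes_with_def by (metis matrix_mul_assoc)

section \<open>Ordered matrix products\<close>

lemma mat_prod_0 [simp]: "mat_prod 0 F = mat 1"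
  by (simp add: mat_prod_def)

lemma mat_prod_Suc [simp]: "mat_prod (Suc k) F = mat_prod k F ** F (Suc k)"
proof -
  \<comment> \<open>The seed of the fold is generalised to \<open>Z\<close>, since appending
    \<open>F (Suc k)\<close> to the list turns the seed \<open>mat 1\<close> into that
    factor.\<close>
  have "foldr (\<lambda>i M. F i ** M) xs Z = foldr (\<lambda>i M. F i ** M) xs (mat 1) ** Z"
    for xs and Z :: "complex^'a^'a"
    by (induction xs) (simp_all add: matrix_mul_assoc)
  from this[of "[1..<Suc k]" "F (Suc k)"] show ?thesis
    by (simp add: mat_prod_def)
qed

lemma mat_prod_add: "mat_prod (a + b) F = mat_prod a F ** mat_prod b (\<lambda>i. F (a + i))"
  by (induction b) (simp_all add: matrix_mul_assoc)

lemma mat_prod_cong: "(\<And>i. i \<in> {1..k} \<Longrightarrow> F i = G i) \<Longrightarrow> mat_prod k F = mat_prod k G"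
  by (induction k) auto

lemma commutes_with_mat_prod:
  "(\<And>i. i \<in> {1..k} \<Longrightarrow> commutes_with Z (F i)) \<Longrightarrow> commutes_with Z (mat_prod k F)"
proof (induction k)
  case 0
  then show ?case by (simp add: commutes_with_def)
next
  case (Suc k)
  then show ?case by (auto intro: commutes_with_mult)
qed

text \<open>The last factor commutes with the product of the earlier ones, so
  \<open>psd_mult\<close> applies. Commutation is asked only of distinct positions, as matrices
  within one chain may fail to commute.\<close>

lemma psd_mat_prod:
  assumes "\<And>i. i \<in> {1..k} \<Longrightarrow> psd (F i)"
    and "\<And>i j. i \<in> {1..k} \<Longrightarrow> j \<in> {1..k} \<Longrightarrow> i \<noteq> j \<Longrightarrow> commutes_with (F i) (F j)"
  shows "psd (mat_prod k F)"
  using assms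
proof (induction k)
  case (Suc k)
  have "commutes_with (F (Suc k)) (mat_prod k F)"
    by (intro commutes_with_mat_prod Suc.prems) auto
  then show ?case
    using Suc by (auto intro!: psd_mult commutes_with_sym)
qed simp

section \<open>Loewner order and chains\<close>

lemma loewner_le_of_psd:
  assumes "psd A" "psd B" "psd (B - A)"
  shows "A \<preceq>\<^sub>L B"
  using assms by (simp add: loewner_le_def psd_hermitian)

lemma psd_diff_of_chain:
  fixes B :: "nat \<Rightarrow> complex^'m^'m"
  assumes chain: "\<forall>j\<in>{1..<n}. B j \<preceq>\<^sub>L B (j + 1)" and "1 \<le> a" "a \<le> b" "b \<le> n"
  shows "psd (B b - B a)"
  using assms(3,4)
proof (induction b rule: dec_induct)
  case (step b)
  then have "psd (B (b + 1) - B b)"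
    using chain \<open>1 \<le> a\<close> by (auto simp: loewner_le_def)
  with step have "psd ((B (b + 1) - B b) + (B b - B a))"
    by (intro psd_add) auto
  then show ?case by simp
qed simp

section \<open>Sums of products\<close>

text \<open>Abel summation: \<open>B l\<close> is the sum of the increments \<open>D t\<close> with
  \<open>t \<le> l\<close>, and exchanging the two sums collects all \<open>P i\<close> that meet a
  given increment. Setting \<open>D 1 = B 1\<close> amounts to starting the chain at zero.\<close>

lemma sum_mult_by_increments:
  fixes B :: "nat \<Rightarrow> complex^'m^'m"
  assumes "finite U" and f: "\<And>i. i \<in> U \<Longrightarrow> f i \<in> {1..n}"
  defines "D \<equiv> \<lambda>t. if t = 1 then B 1 else B t - B (t - 1)"
  shows "(\<Sum>i\<in>U. P i ** B (f i)) = (\<Sum>t=1..n. (\<Sum>i\<in>{i \<in> U. t \<le> f i}. P i) ** D t)"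
proof -
  have B: "B l = (\<Sum>t=1..l. D t)" if "1 \<le> l" for l
    using that by (induction l rule: dec_induct) (auto simp: D_def)
  have "(\<Sum>i\<in>U. P i ** B (f i)) = (\<Sum>i\<in>U. \<Sum>t=1..n. if t \<le> f i then P i ** D t else 0)"
  proof (rule sum.cong[OF refl])
    fix i assume "i \<in> U"
    from f[OF this] have "{t \<in> {1..n}. t \<le> f i} = {1..f i}" "1 \<le> f i" by auto
    then show "P i ** B (f i) = (\<Sum>t=1..n. if t \<le> f i then P i ** D t else 0)"
      by (simp add: B matrix_sum_ldistrib flip: sum.inter_filter)
  qed
  also have "\<dots> = (\<Sum>t=1..n. \<Sum>i\<in>U. if t \<le> f i then P i ** D t else 0)"
    by (rule sum.swap)
  also have "\<dots> = (\<Sum>t=1..n. (\<Sum>i\<in>{i \<in> U. t \<le> f i}. P i) ** D t)"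
    using \<open>finite U\<close> by (simp add: matrix_sum_rdistrib flip: sum.inter_filter)
  finally show ?thesis .
qed

text \<open>The passage from \<open>{1..n}\<close> to subsets \<open>U\<close> is what lets the induction on \<open>k\<close> absorb the
  truncated sums produced by Abel summation in the last factor.\<close>

lemma psd_sum_top_minus_sum_permuted:
  fixes A :: "nat \<Rightarrow> nat \<Rightarrow> complex^'m^'m"
  assumes psd: "\<forall>i\<in>{1..k}. \<forall>j\<in>{1..n}. psd (A i j)"
    and chain: "\<forall>i\<in>{1..k}. \<forall>j\<in>{1..<n}. A i j \<preceq>\<^sub>L A i (j + 1)"
    and comm: "\<forall>i\<in>{1..k}. \<forall>m\<in>{1..k}. i \<noteq> m \<longrightarrow>
                 (\<forall>j\<in>{1..n}. \<forall>l\<in>{1..n}. commutes_with (A i j) (A m l))"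
    and perm: "\<forall>j\<in>{1..k}. \<sigma> j permutes {1..n}"
    and "U \<subseteq> {1..n}"
  shows "psd ((\<Sum>i\<in>{n - card U<..n}. mat_prod k (\<lambda>j. A j i))
            - (\<Sum>i\<in>U. mat_prod k (\<lambda>j. A j (\<sigma> j i))))"
  using assms
proof (induction k arbitrary: U)
  case 0
  \<comment> \<open>Both sums consist of \<open>card U\<close> copies of \<open>mat 1\<close>; the
    bound keeps the truncated subtraction \<open>n - card U\<close> exact.\<close>
  have "card U \<le> n" using card_mono[OF _ \<open>U \<subseteq> {1..n}\<close>] by simp
  then show ?case by simp
next
  case (Suc k)
  define B where "B = A (Suc k)"
  define s where "s = \<sigma> (Suc k)"
  define P where "P = (\<lambda>i. mat_prod k (\<lambda>j. A j (\<sigma> j i)))"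
  define Q where "Q = (\<lambda>i. mat_prod k (\<lambda>j. A j i))"
  define D where "D = (\<lambda>t. if t = 1 then B 1 else B t - B (t - 1))"
  \<comment> \<open>\<open>V t\<close> and \<open>W t\<close> index the terms that multiply the
    increment \<open>D t\<close> of the last factor, in the permuted and in the sorted
    arrangement.\<close>
  define V where "V = (\<lambda>t. {i \<in> U. t \<le> s i})"
  define W where "W = (\<lambda>t. {i \<in> {n - card U<..n}. t \<le> i})"
  have fin: "finite U" using Suc.prems(5) finite_subset by blast
  have s: "s permutes {1..n}" using Suc.prems(4) by (simp add: s_def)
  have \<sigma>: "\<sigma> j i \<in> {1..n}" if "j \<in> {1..Suc k}" "i \<in> {1..n}" for i j
    using Suc.prems(4) that permutes_in_image[of "\<sigma> j" "{1..n}" i] by simp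
  have IH: "psd (sum Q {n - card T<..n} - sum P T)" if "T \<subseteq> {1..n}" for T
    unfolding P_def Q_def using Suc.prems that by (intro Suc.IH) auto
  have Dpsd: "psd (D t)" if "t \<in> {1..n}" for t
    using that Suc.prems(1) psd_diff_of_chain[of n B "t - 1" t] Suc.prems(2)
    by (auto simp: D_def B_def)
  have Qpsd: "psd (Q i)" if "i \<in> {1..n}" for i
    unfolding Q_def using Suc.prems(1,3) that by (intro psd_mat_prod) auto
  have DB: "commutes_with Z (D t)" if "\<And>l. l \<in> {1..n} \<Longrightarrow> commutes_with Z (B l)" "t \<in> {1..n}" for Z t
    using that(2) by (auto simp: D_def intro!: commutes_with_diff that(1))
  have DQ: "commutes_with (Q i) (D t)" if "i \<in> {1..n}" "t \<in> {1..n}" for i t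
    using that Suc.prems(3) unfolding Q_def B_def
    by (intro DB commutes_with_mat_prod[THEN commutes_with_sym]) (auto simp: B_def)
  have DP: "commutes_with (P i) (D t)" if "i \<in> {1..n}" "t \<in> {1..n}" for i t
    using that Suc.prems(3) \<sigma> unfolding P_def B_def
    by (intro DB commutes_with_mat_prod[THEN commutes_with_sym]) (auto simp: B_def)
  have main: "psd ((sum Q (W t) - sum P (V t)) ** D t)" if t: "t \<in> {1..n}" for t
  proof (rule psd_mult)
    have VU: "V t \<subseteq> U" by (auto simp: V_def)
    have V: "V t \<subseteq> {1..n}" using VU Suc.prems(5) by auto
    \<comment> \<open>\<open>s\<close> maps \<open>V t\<close> injectively into
      \<open>{t..n}\<close>. Together with \<open>card (V t) \<le> card U\<close> this puts the top
      \<open>card (V t)\<close> indices inside \<open>W t\<close>.\<close>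
    have "card (V t) = card (s ` V t)"
      using card_image permutes_inj_on[OF s] by metis
    also have "\<dots> \<le> card {t..n}"
      using V permutes_in_image[OF s] by (intro card_mono) (auto simp: V_def, fastforce)
    finally have "card (V t) \<le> Suc n - t" by simp
    moreover have "card (V t) \<le> card U" using card_mono[OF fin VU] .
    ultimately have sub: "{n - card (V t)<..n} \<subseteq> W t"
      by (auto simp: W_def)
    \<comment> \<open>The induction hypothesis compares \<open>V t\<close> with equally many top
      indices; the remaining indices of \<open>W t\<close> only add positive semidefinite
      terms.\<close>
    have "psd (sum Q (W t - {n - card (V t)<..n}) + (sum Q {n - card (V t)<..n} - sum P (V t)))"
      using V by (intro psd_add IH psd_sum Qpsd) (auto simp: W_def)
    moreover have "finite (W t)" by (simp add: W_def)
    ultimately show "psd (sum Q (W t) - sum P (V t))"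
      using sum.subset_diff[OF sub, of Q] by (simp add: algebra_simps)
    have "commutes_with (D t) (sum Q (W t) - sum P (V t))"
      using V t by (intro commutes_with_diff commutes_with_sum commutes_with_sym[OF DQ]
          commutes_with_sym[OF DP]) (auto simp: W_def)
    then show "commutes_with (sum Q (W t) - sum P (V t)) (D t)"
      by (rule commutes_with_sym)
  qed (use t Dpsd in auto)
  have "(\<Sum>i\<in>U. P i ** B (s i)) = (\<Sum>t=1..n. sum P (V t) ** D t)"
    unfolding V_def D_def using Suc.prems(5) permutes_in_image[OF s]
    by (intro sum_mult_by_increments fin) auto
  moreover have "(\<Sum>i\<in>{n - card U<..n}. Q i ** B i) = (\<Sum>t=1..n. sum Q (W t) ** D t)"
    unfolding W_def D_def by (rule sum_mult_by_increments[where f = "\<lambda>i. i"]) auto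
  ultimately show ?case
    using psd_sum[of "{1..n}" "\<lambda>t. (sum Q (W t) - sum P (V t)) ** D t", OF main]
    by (simp add: P_def Q_def B_def s_def matrix_diff_rdistrib sum_subtractf)
qed

section \<open>Products of sums\<close>

text \<open>The two products share a prefix \<open>L\<close> and a suffix \<open>R\<close>, so their
  difference is \<open>L ** (E ** R)\<close> with \<open>E\<close> the difference of the middle
  pairs. These three factors are positive semidefinite and commute.\<close>

lemma psd_mat_prod_diff_adjacent:
  fixes F G :: "nat \<Rightarrow> complex^'m^'m"
  assumes i: "i \<in> {1..<n}"
    and same: "\<And>l. l \<in> {1..n} \<Longrightarrow> l \<noteq> i \<Longrightarrow> l \<noteq> i + 1 \<Longrightarrow> F l = G l"
    and psd: "\<And>l. l \<in> {1..n} \<Longrightarrow> psd (F l)"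
    and diff: "psd (F i ** F (i + 1) - G i ** G (i + 1))"
    and FF: "\<And>l m. l \<in> {1..n} \<Longrightarrow> m \<in> {1..n} \<Longrightarrow> commutes_with (F l) (F m)"
    and FG: "\<And>l m. l \<in> {1..n} \<Longrightarrow> m \<in> {1..n} \<Longrightarrow> commutes_with (F l) (G m)"
  shows "psd (mat_prod n F - mat_prod n G)"
proof -
  define a b where "a = i - 1" and "b = n - (i + 1)"
  have n: "n = a + (2 + b)" and ai: "Suc a = i" using i by (auto simp: a_def b_def)
  define L where "L = mat_prod a F"
  define R where "R = mat_prod b (\<lambda>l. F (a + (2 + l)))"
  define E where "E = F i ** F (i + 1) - G i ** G (i + 1)"
  have split: "mat_prod n H = mat_prod a H ** (H i ** H (i + 1) ** mat_prod b (\<lambda>l. H (a + (2 + l))))"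
    for H :: "nat \<Rightarrow> complex^'m^'m"
    unfolding n mat_prod_add by (simp add: numeral_2_eq_2 flip: ai)
  have LG: "mat_prod a G = L"
    unfolding L_def using n ai by (intro mat_prod_cong same[symmetric]) auto
  have RG: "mat_prod b (\<lambda>l. G (a + (2 + l))) = R"
    unfolding R_def using n ai by (intro mat_prod_cong same[symmetric]) auto
  have eq: "mat_prod n F - mat_prod n G = L ** (E ** R)"
    unfolding split[of F] split[of G] LG RG
    by (simp add: L_def R_def E_def matrix_diff_ldistrib matrix_diff_rdistrib)
  have cE: "commutes_with (F l) E" if "l \<in> {1..n}" for l
    unfolding E_def using that i by (intro commutes_with_diff commutes_with_mult FF FG) auto
  have cR: "commutes_with Z R" if "\<And>l. l \<in> {1..n} \<Longrightarrow> commutes_with Z (F l)" for Z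
    unfolding R_def using n by (intro commutes_with_mat_prod that) auto
  have ER: "commutes_with E R" by (rule cR, rule commutes_with_sym, rule cE)
  have "commutes_with (E ** R) L"
    unfolding L_def using n
    by (intro commutes_with_mat_prod commutes_with_sym[OF commutes_with_mult] cE cR FF) auto
  then have "commutes_with L (E ** R)" by (rule commutes_with_sym)
  moreover have "psd L" "psd R"
    unfolding L_def R_def using n by (auto intro!: psd_mat_prod psd FF)
  moreover have "psd E" unfolding E_def by (rule diff)
  ultimately show ?thesis
    unfolding eq using ER by (intro psd_mult)
qed

text \<open>With \<open>m\<close> the sum of the smaller members and \<open>p\<close>,
  \<open>q\<close> the excesses of \<open>x\<close> and \<open>y\<close> over them,
  \<open>(m + p) ** (m + q) - m ** (m + p + q) = p ** q\<close> because \<open>p\<close> and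
  \<open>m\<close> commute.\<close>

lemma psd_diff_of_sorted_pair:
  fixes x y :: "nat \<Rightarrow> complex^'m^'m"
  assumes "finite J"
    and less: "\<And>j. j \<in> J \<Longrightarrow> S j \<Longrightarrow> psd (x j - y j)"
    and greater: "\<And>j. j \<in> J \<Longrightarrow> \<not> S j \<Longrightarrow> psd (y j - x j)"
    and comm: "\<And>j l u v. j \<in> J \<Longrightarrow> l \<in> J \<Longrightarrow> u \<in> {x, y} \<Longrightarrow> v \<in> {x, y} \<Longrightarrow> commutes_with (u j) (v l)"
  shows "psd (sum x J ** sum y J
    - (\<Sum>j\<in>J. if S j then y j else x j) ** (\<Sum>j\<in>J. if S j then x j else y j))"
proof -
  define m where "m = (\<Sum>j\<in>J. if S j then y j else x j)"
  define p where "p = (\<Sum>j\<in>J. if S j then x j - y j else 0)"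
  define q where "q = (\<Sum>j\<in>J. if S j then 0 else y j - x j)"
  have X: "sum x J = m + p" and Y: "sum y J = m + q"
    and M: "(\<Sum>j\<in>J. if S j then x j else y j) = m + p + q"
    unfolding m_def p_def q_def sum.distrib[symmetric] by (auto intro!: sum.cong)
  have zero: "commutes_with Z 0" for Z :: "complex^'m^'m"
    by (simp add: commutes_with_def matrix_matrix_mult_def vec_eq_iff)
  have c: "commutes_with (u j) p" "commutes_with (u j) q" if "u \<in> {x, y}" "j \<in> J" for u j
    unfolding p_def q_def using that comm by (auto intro!: commutes_with_sum commutes_with_diff zero)
  have "commutes_with p m"
    unfolding m_def by (intro commutes_with_sum) (auto intro!: commutes_with_sym[OF c(1)])
  then have "sum x J ** sum y J - m ** (m + p + q) = p ** q"
    unfolding X Y commutes_with_def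
    by (simp add: matrix_add_ldistrib matrix_add_rdistrib)
  moreover have "commutes_with q p"
    unfolding p_def using c(2)[of x, THEN commutes_with_sym] c(2)[of y, THEN commutes_with_sym]
    by (intro commutes_with_sum) (simp add: commutes_with_diff zero)
  moreover have "psd p" "psd q"
    unfolding p_def q_def using less greater by (auto intro!: psd_sum)
  ultimately show ?thesis
    unfolding M m_def[symmetric] by (simp add: psd_mult commutes_with_sym)
qed

text \<open>Injectivity makes each ascent strict, so \<open>s i \<ge> i\<close> throughout, and only
  the identity permutation satisfies this.\<close>

lemma permutes_eq_id_of_no_descent:
  fixes s :: "nat \<Rightarrow> nat"
  assumes s: "s permutes {1..n}" and le: "\<And>i. i \<in> {1..<n} \<Longrightarrow> s i \<le> s (i + 1)"
  shows "s = id"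
proof (rule permutes_natset_ge[OF s], rule ballI)
  fix i assume "i \<in> {1..n}"
  then have "1 \<le> i" "i \<le> n" by auto
  then show "s i \<ge> i"
  proof (induction i rule: dec_induct)
    case base
    then show ?case using permutes_in_image[OF s, of 1] by auto
  next
    case (step i)
    have "s i \<noteq> s (i + 1)" using permutes_inj[OF s] by (simp add: inj_eq)
    with le[of i] step show ?case by auto
  qed
qed

text \<open>Only the terms at \<open>i\<close> and \<open>i + 1\<close> change, and together they
  gain \<open>s i - s (i + 1)\<close>.\<close>

lemma sum_index_mult_transpose:
  fixes s :: "nat \<Rightarrow> nat"
  assumes i: "i \<in> {1..<n}" and desc: "s (i + 1) < s i"
  shows "(\<Sum>l=1..n. l * s l) < (\<Sum>l=1..n. l * (s \<circ> Transposition.transpose i (i + 1)) l)"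
proof -
  have split: "(\<Sum>l=1..n. f l) = f i + f (i + 1) + sum f ({1..n} - {i, i + 1})" for f :: "nat \<Rightarrow> nat"
    using i sum.subset_diff[of "{i, i + 1}" "{1..n}" f] by (simp add: add_ac)
  have "i * s i + (i + 1) * s (i + 1) < i * s (i + 1) + (i + 1) * s i"
    using desc by simp
  moreover have "(\<Sum>l\<in>{1..n} - {i, i + 1}. l * (s \<circ> Transposition.transpose i (i + 1)) l)
      = (\<Sum>l\<in>{1..n} - {i, i + 1}. l * s l)"
    by (intro sum.cong) (auto simp: Transposition.transpose_def)
  ultimately show ?thesis unfolding split by simp
qed

text \<open>Bubble sort: at an adjacent descent all the \<open>\<sigma> j\<close> are sorted simultaneously, and the
  potential \<open>\<Sum>j. \<Sum>i. i * \<sigma> j i\<close> increases.\<close>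

lemma psd_prod_permuted_minus_prod:
  fixes A :: "nat \<Rightarrow> nat \<Rightarrow> complex^'m^'m"
  assumes psd: "\<forall>i\<in>{1..k}. \<forall>j\<in>{1..n}. psd (A i j)"
    and chain: "\<forall>i\<in>{1..k}. \<forall>j\<in>{1..<n}. A i j \<preceq>\<^sub>L A i (j + 1)"
    and comm: "\<forall>i\<in>{1..k}. \<forall>j\<in>{1..n}. \<forall>m\<in>{1..k}. \<forall>l\<in>{1..n}. commutes_with (A i j) (A m l)"
    and perm: "\<forall>j\<in>{1..k}. \<sigma> j permutes {1..n}"
  shows "psd (mat_prod n (\<lambda>i. \<Sum>j=1..k. A j (\<sigma> j i)) - mat_prod n (\<lambda>i. \<Sum>j=1..k. A j i))"
  using perm
\<comment> \<open>Each \<open>l * \<sigma> j l\<close> is at most \<open>n * n\<close>, so the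
  potential stays below the constant and its increase strictly lowers this natural-number
  difference.\<close>
proof (induction "k * (n * (n * n)) - (\<Sum>j=1..k. \<Sum>l=1..n. l * \<sigma> j l)" arbitrary: \<sigma> rule: less_induct)
  case less
  define pot where "pot = (\<lambda>\<sigma> :: nat \<Rightarrow> nat \<Rightarrow> nat. \<Sum>j=1..k. \<Sum>l=1..n. l * \<sigma> j l)"
  have in_range: "\<tau> j l \<in> {1..n}" if "\<forall>j\<in>{1..k}. \<tau> j permutes {1..n}" "j \<in> {1..k}" "l \<in> {1..n}"
    for \<tau> :: "nat \<Rightarrow> nat \<Rightarrow> nat" and j l
    using that permutes_in_image[of "\<tau> j" "{1..n}" l] by simp
  show ?case
  proof (cases "\<exists>i\<in>{1..<n}. \<exists>j\<in>{1..k}. \<sigma> j (i + 1) < \<sigma> j i")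
    case False
    then have "\<sigma> j = id" if "j \<in> {1..k}" for j
      using that less.prems by (intro permutes_eq_id_of_no_descent[of _ n]) (auto simp: not_less)
    then have "mat_prod n (\<lambda>i. \<Sum>j=1..k. A j (\<sigma> j i)) = mat_prod n (\<lambda>i. \<Sum>j=1..k. A j i)"
      by (intro mat_prod_cong sum.cong) auto
    then show ?thesis by simp
  next
    case True
    then obtain i j0 where i: "i \<in> {1..<n}" and j0: "j0 \<in> {1..k}" "\<sigma> j0 (i + 1) < \<sigma> j0 i"
      by blast
    \<comment> \<open>\<open>S\<close> marks the rows that descend at \<open>i\<close>. Exchanging
      the two positions in just these rows puts the smaller matrix of every row at
      \<open>i\<close>.\<close>
    define S where "S = (\<lambda>j. \<sigma> j (i + 1) < \<sigma> j i)"
    define \<tau> where "\<tau> = (\<lambda>j. if S j then \<sigma> j \<circ> Transposition.transpose i (i + 1) else \<sigma> j)"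
    define F where "F = (\<lambda>\<sigma> i. \<Sum>j=1..k. A j ((\<sigma> :: nat \<Rightarrow> nat \<Rightarrow> nat) j i))"
    have \<tau>: "\<forall>j\<in>{1..k}. \<tau> j permutes {1..n}"
      using less.prems i by (auto simp: \<tau>_def intro!: permutes_compose permutes_swap_id)
    have "pot \<sigma> < pot \<tau>"
      unfolding pot_def
    proof (rule sum_strict_mono_ex1)
      have lt: "(\<Sum>l=1..n. l * \<sigma> j l) < (\<Sum>l=1..n. l * \<tau> j l)" if "S j" for j
        using sum_index_mult_transpose[OF i, of "\<sigma> j"] that by (simp add: \<tau>_def S_def)
      have "\<tau> j = \<sigma> j" if "\<not> S j" for j using that by (simp add: \<tau>_def)
      with lt show "\<forall>j\<in>{1..k}. (\<Sum>l=1..n. l * \<sigma> j l) \<le> (\<Sum>l=1..n. l * \<tau> j l)"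
        by (metis le_refl less_imp_le)
      show "\<exists>j\<in>{1..k}. (\<Sum>l=1..n. l * \<sigma> j l) < (\<Sum>l=1..n. l * \<tau> j l)"
        using lt[of j0] j0 unfolding S_def by blast
    qed simp
    moreover have "pot \<tau> \<le> k * (n * (n * n))"
    proof -
      have "(\<Sum>l=1..n. l * \<tau> j l) \<le> n * (n * n)" if "j \<in> {1..k}" for j
        using sum_bounded_above[of "{1..n}" "\<lambda>l. l * \<tau> j l" "n * n"] in_range[OF \<tau> that]
        by (auto intro!: mult_le_mono)
      then show ?thesis
        using sum_bounded_above[of "{1..k}" "\<lambda>j. \<Sum>l=1..n. l * \<tau> j l" "n * (n * n)"]
        by (simp add: pot_def)
    qed
    ultimately have IH: "psd (mat_prod n (F \<tau>) - mat_prod n (\<lambda>i. \<Sum>j=1..k. A j i))"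
      unfolding F_def using less.hyps[OF _ \<tau>] by (simp add: pot_def)
    have diff: "psd (A j b - A j a)" if "j \<in> {1..k}" "a \<in> {1..n}" "b \<in> {1..n}" "a \<le> b" for j a b
      using psd_diff_of_chain[of n "A j" a b] chain that by auto
    have commF: "commutes_with (F \<mu> l) (F \<nu> m)"
      if "\<forall>j\<in>{1..k}. \<mu> j permutes {1..n}" "\<forall>j\<in>{1..k}. \<nu> j permutes {1..n}"
        "l \<in> {1..n}" "m \<in> {1..n}" for \<mu> \<nu> l m
      unfolding F_def using that in_range comm
      by (intro commutes_with_sum commutes_with_sum[THEN commutes_with_sym]) auto
    have "psd (mat_prod n (F \<sigma>) - mat_prod n (F \<tau>))"
    proof (rule psd_mat_prod_diff_adjacent[OF i])
      show "F \<sigma> l = F \<tau> l" if "l \<noteq> i" "l \<noteq> i + 1" for l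
        unfolding F_def using that by (intro sum.cong) (auto simp: \<tau>_def Transposition.transpose_def)
      show "psd (F \<sigma> l)" if "l \<in> {1..n}" for l
        unfolding F_def using that psd in_range[OF less.prems] by (intro psd_sum) auto
      \<comment> \<open>Here \<open>x j\<close> is \<open>A j (\<sigma> j i)\<close> and
        \<open>y j\<close> is \<open>A j (\<sigma> j (i + 1))\<close>; the chain condition orders
        each pair as \<open>S\<close> prescribes.\<close>
      have "psd (F \<sigma> i ** F \<sigma> (i + 1)
          - (\<Sum>j=1..k. if S j then A j (\<sigma> j (i + 1)) else A j (\<sigma> j i))
            ** (\<Sum>j=1..k. if S j then A j (\<sigma> j i) else A j (\<sigma> j (i + 1))))"
        unfolding F_def using i in_range[OF less.prems] comm
        by (intro psd_diff_of_sorted_pair diff) (auto simp: S_def)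
      moreover have "(\<Sum>j=1..k. if S j then A j (\<sigma> j (i + 1)) else A j (\<sigma> j i)) = F \<tau> i"
        "(\<Sum>j=1..k. if S j then A j (\<sigma> j i) else A j (\<sigma> j (i + 1))) = F \<tau> (i + 1)"
        unfolding F_def by (auto simp: \<tau>_def intro!: sum.cong)
      ultimately show "psd (F \<sigma> i ** F \<sigma> (i + 1) - F \<tau> i ** F \<tau> (i + 1))" by simp
    qed (use commF less.prems \<tau> in auto)
    from psd_add[OF this IH] show ?thesis by (simp add: F_def)
  qed
qed

section \<open>The two inequalities in the Loewner order\<close>

theorem theorem28:
  fixes A :: "nat \<Rightarrow> nat \<Rightarrow> complex^'m^'m" and k n :: nat
  assumes psd: "\<forall>i\<in>{1..k}. \<forall>j\<in>{1..n}. psd (A i j)"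
    and chain: "\<forall>i\<in>{1..k}. \<forall>j\<in>{1..<n}. A i j \<preceq>\<^sub>L A i (j + 1)"
    and comm: "\<forall>i\<in>{1..k}. \<forall>m\<in>{1..k}. i \<noteq> m \<longrightarrow>
                 (\<forall>j\<in>{1..n}. \<forall>l\<in>{1..n}. commutes_with (A i j) (A m l))"
  shows "(\<forall>\<sigma> :: nat \<Rightarrow> nat \<Rightarrow> nat. (\<forall>j\<in>{1..k}. \<sigma> j permutes {1..n}) \<longrightarrow>
            (\<Sum>i=1..n. mat_prod k (\<lambda>j. A j (\<sigma> j i))) \<preceq>\<^sub>L (\<Sum>i=1..n. mat_prod k (\<lambda>j. A j i)))
       \<and> ((\<forall>i\<in>{1..k}. \<forall>j\<in>{1..n}. \<forall>m\<in>{1..k}. \<forall>l\<in>{1..n}. commutes_with (A i j) (A m l)) \<longrightarrow>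
          (\<forall>\<sigma> :: nat \<Rightarrow> nat \<Rightarrow> nat. (\<forall>j\<in>{1..k}. \<sigma> j permutes {1..n}) \<longrightarrow>
            mat_prod n (\<lambda>i. \<Sum>j=1..k. A j i) \<preceq>\<^sub>L mat_prod n (\<lambda>i. \<Sum>j=1..k. A j (\<sigma> j i))))"
proof (intro conjI impI allI)
  fix \<sigma> :: "nat \<Rightarrow> nat \<Rightarrow> nat"
  assume \<sigma>: "\<forall>j\<in>{1..k}. \<sigma> j permutes {1..n}"
  \<comment> \<open>The order requires Hermitian sides, obtained here from positive
    semidefiniteness; the general \<open>\<tau>\<close> covers both \<open>\<sigma>\<close> and the
    identity arrangement.\<close>
  have psd_sums: "psd (\<Sum>i=1..n. mat_prod k (\<lambda>j. A j (\<tau> j i)))"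
    if "\<And>i j. i \<in> {1..n} \<Longrightarrow> j \<in> {1..k} \<Longrightarrow> \<tau> j i \<in> {1..n}" for \<tau> :: "nat \<Rightarrow> nat \<Rightarrow> nat"
    using that psd comm by (intro psd_sum psd_mat_prod) auto
  have in_range: "\<sigma> j i \<in> {1..n}" if "i \<in> {1..n}" "j \<in> {1..k}" for i j
    using \<sigma> that permutes_in_image[of "\<sigma> j" "{1..n}" i] by simp
  \<comment> \<open>For \<open>U = {1..n}\<close> the top \<open>card U\<close> indices are all
    indices, so the subset statement yields the full sums.\<close>
  have "{n - card {1..n}<..n} = {1..n}" by auto
  then show "(\<Sum>i=1..n. mat_prod k (\<lambda>j. A j (\<sigma> j i))) \<preceq>\<^sub>L (\<Sum>i=1..n. mat_prod k (\<lambda>j. A j i))"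
    using psd_sum_top_minus_sum_permuted[OF psd chain comm \<sigma> order.refl]
      psd_sums[of \<sigma>, OF in_range] psd_sums[of "\<lambda>j i. i"]
    by (intro loewner_le_of_psd) simp_all
next
  fix \<sigma> :: "nat \<Rightarrow> nat \<Rightarrow> nat"
  assume all: "\<forall>i\<in>{1..k}. \<forall>j\<in>{1..n}. \<forall>m\<in>{1..k}. \<forall>l\<in>{1..n}. commutes_with (A i j) (A m l)"
    and \<sigma>: "\<forall>j\<in>{1..k}. \<sigma> j permutes {1..n}"
  have psd_prods: "psd (mat_prod n (\<lambda>i. \<Sum>j=1..k. A j (\<tau> j i)))"
    if "\<And>i j. i \<in> {1..n} \<Longrightarrow> j \<in> {1..k} \<Longrightarrow> \<tau> j i \<in> {1..n}" for \<tau> :: "nat \<Rightarrow> nat \<Rightarrow> nat"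
    using that psd all
    by (intro psd_mat_prod psd_sum commutes_with_sum commutes_with_sum[THEN commutes_with_sym]) auto
  have in_range: "\<sigma> j i \<in> {1..n}" if "i \<in> {1..n}" "j \<in> {1..k}" for i j
    using \<sigma> that permutes_in_image[of "\<sigma> j" "{1..n}" i] by simp
  show "mat_prod n (\<lambda>i. \<Sum>j=1..k. A j i) \<preceq>\<^sub>L mat_prod n (\<lambda>i. \<Sum>j=1..k. A j (\<sigma> j i))"
    using psd_prod_permuted_minus_prod[OF psd chain all \<sigma>]
      psd_prods[of \<sigma>, OF in_range] psd_prods[of "\<lambda>j i. i"]
    by (intro loewner_le_of_psd) simp_all
qed

end
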